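(* Suppose that $\mu$ is a non-atomic strictly positive measure on a Boolean algebra $\mathfrak{B}$. Then there is a partition of unity $\{a_n\colon n<\omega\}$ such that for every $n$ and every $\mathbf{0}\neq b\le a_n$ we have $\mathrm{ur}(\mu\,|\,b)=\mathrm{ur}(\mu\,|\,a_n)$.
   Context: A measure on a Boolean algebra is a finitely additive non-negative finite function, normalized to have value $1$ at the unit; it is non-atomic if for every $\varepsilon>0$ there is a finite partition of unity into elements of measure at most $\varepsilon$. A partition of unity is a maximal antichain (family of pairwise disjoint elements with supremum $\mathbf{1}$). A family $\mathcal{F}\subseteq\mathfrak{B}$ is uniformly $\mu$-dense if for every $b\in\mathfrak{B}$ and $\varepsilon>0$ there is $a\in\mathcal{F}$ with $a\le b$ and $\mu(b\setminus a)<\varepsilon$. $\mathrm{ur}(\mu)$ is the least cardinality of a uniformly $\mu$-dense family $\mathcal{F}\subseteq\mathfrak{B}$. For $b\neq\mathbf{0}$, $\mu\,|\,b$ denotes the restriction of $\mu$ to the relative algebra $\{c\in\mathfrak{B}:c\le b\}$ (normalization does not affect $\mathrm{ur}$). *)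

theory Defs
  imports Complex_Main "HOL-Library.Lub_Glb"
begin

unbundle cardinal_syntax

definition ba_measure :: "('a::boolean_algebra \<Rightarrow> real) \<Rightarrow> bool" where
  "ba_measure \<mu> \<longleftrightarrow>
     (\<forall>a. 0 \<le> \<mu> a) \<and> \<mu> top = 1 \<and>
     (\<forall>a b. inf a b = bot \<longrightarrow> \<mu> (sup a b) = \<mu> a + \<mu> b)"

definition strictly_positive :: "('a::boolean_algebra \<Rightarrow> real) \<Rightarrow> bool" where
  "strictly_positive \<mu> \<longleftrightarrow> (\<forall>a. a \<noteq> bot \<longrightarrow> 0 < \<mu> a)"

text \<open>Members of an antichain are non-zero. The algebra need not be complete, so \<^const>\<open>isLub\<close>
  asserts that the supremum exists and equals the unit, which for pairwise disjoint non-zero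
  elements amounts to maximality of the antichain.\<close>

definition partition_of_unity :: "'a::boolean_algebra set \<Rightarrow> bool" where
  "partition_of_unity P \<longleftrightarrow>
     bot \<notin> P \<and> pairwise (\<lambda>a b. inf a b = bot) P \<and> isLub UNIV P top"

definition non_atomic :: "('a::boolean_algebra \<Rightarrow> real) \<Rightarrow> bool" where
  "non_atomic \<mu> \<longleftrightarrow>
     (\<forall>\<epsilon>>0. \<exists>P. finite P \<and> partition_of_unity P \<and> (\<forall>a\<in>P. \<mu> a \<le> \<epsilon>))"

text \<open>The next two notions are stated for the relative algebra of all elements below \<open>u\<close>, with
  \<open>\<mu>\<close> restricted to it and not renormalized; \<open>u = top\<close> gives the whole algebra. For
  \<open>a \<le> b \<le> u\<close> the difference \<open>b - a\<close> is the same in the relative algebra as in the ambient one.\<close>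

definition uniformly_dense_below ::
    "('a::boolean_algebra \<Rightarrow> real) \<Rightarrow> 'a \<Rightarrow> 'a set \<Rightarrow> bool" where
  "uniformly_dense_below \<mu> u F \<longleftrightarrow>
     F \<subseteq> {..u} \<and> (\<forall>b\<in>{..u}. \<forall>\<epsilon>>0. \<exists>a\<in>F. a \<le> b \<and> \<mu> (b - a) < \<epsilon>)"

text \<open>\<open>ur_below \<mu> u\<close> is the cardinal \<open>ur(\<mu>|u)\<close>. Cardinals are represented by well-orders, hence are
  determined only up to \<open>=o\<close>; the lemmas below show that the choice is well defined.\<close>

definition ur_below :: "('a::boolean_algebra \<Rightarrow> real) \<Rightarrow> 'a \<Rightarrow> 'a rel" where
  "ur_below \<mu> u = (SOME \<kappa>. (\<exists>F. uniformly_dense_below \<mu> u F \<and> \<kappa> = |F| ) \<and>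
     (\<forall>G. uniformly_dense_below \<mu> u G \<longrightarrow> \<kappa> \<le>o |G| ))"

lemma uniformly_dense_below_atMost:
  assumes "ba_measure \<mu>"
  shows "uniformly_dense_below \<mu> u {..u}"
proof -
  have "\<mu> (sup bot bot) = \<mu> bot + \<mu> bot"
    using assms by (simp add: ba_measure_def del: sup_bot_left sup_bot_right sup_idem)
  then have "\<mu> bot = 0" by simp
  then have "\<mu> (b - b) = 0" for b by (simp add: diff_eq)
  then show ?thesis
    unfolding uniformly_dense_below_def by auto
qed

lemma ur_below_least:
  assumes "ba_measure \<mu>"
  shows "(\<exists>F. uniformly_dense_below \<mu> u F \<and> ur_below \<mu> u = |F| ) \<and>
    (\<forall>G. uniformly_dense_below \<mu> u G \<longrightarrow> ur_below \<mu> u \<le>o |G| )"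
proof -
  let ?R = "{|F| | F. uniformly_dense_below \<mu> u F}"
  have "?R \<noteq> {}" using uniformly_dense_below_atMost[OF assms] by blast
  moreover have "\<forall>r\<in>?R. Well_order r" using card_of_Well_order by blast
  ultimately have "\<exists>\<kappa>\<in>?R. \<forall>r\<in>?R. \<kappa> \<le>o r"
    by (rule exists_minim_Well_order)
  then obtain \<kappa> where "\<kappa> \<in> ?R" "\<forall>r\<in>?R. \<kappa> \<le>o r" ..
  then have "\<exists>\<kappa>. (\<exists>F. uniformly_dense_below \<mu> u F \<and> \<kappa> = |F| ) \<and>
     (\<forall>G. uniformly_dense_below \<mu> u G \<longrightarrow> \<kappa> \<le>o |G| )" by blast
  then show ?thesis unfolding ur_below_def by (rule someI_ex)
qed

end

theory Submission
  imports Defs "HOL-Library.Countable_Set"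
begin

text \<open>Since \<open>ur\<close> is monotone and cardinals are well-ordered, every non-zero element lies above a
  non-zero homogeneous one, that is, one on which \<open>ur\<close> is constant on non-zero parts. Hence a maximal
  antichain of homogeneous elements is a partition of unity. Strict positivity makes it countable;
  splitting one homogeneous element into infinitely many pieces (non-atomicity) before extending to a
  maximal antichain makes it infinite.\<close>

text \<open>Non-zeroness is built in, so that a family of homogeneous elements omits
  \<open>bot\<close>, as a partition of unity must.\<close>

definition homogeneous :: "('a::boolean_algebra \<Rightarrow> real) \<Rightarrow> 'a \<Rightarrow> bool" where
  "homogeneous \<mu> a \<longleftrightarrow> a \<noteq> bot \<and> (\<forall>b. b \<noteq> bot \<and> b \<le> a \<longrightarrow> ur_below \<mu> b =o ur_below \<mu> a)"

abbreviation pairwise_disjoint :: "'a::boolean_algebra set \<Rightarrow> bool" where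
  "pairwise_disjoint P \<equiv> pairwise (\<lambda>a b. inf a b = bot) P"

lemma ba_measure_diff:
  assumes "ba_measure \<mu>" and "b \<le> a"
  shows "\<mu> a = \<mu> b + \<mu> (a - b)"
proof -
  have "inf b (a - b) = bot"
    by (simp add: diff_eq inf_left_commute)
  then have "\<mu> (sup b (a - b)) = \<mu> b + \<mu> (a - b)"
    using assms(1) by (simp add: ba_measure_def)
  moreover have "sup b (a - b) = a"
    using assms(2) by (simp add: diff_eq sup_inf_distrib1 sup_absorb2)
  ultimately show ?thesis by simp
qed

lemma ba_measure_mono:
  assumes "ba_measure \<mu>" and "b \<le> a"
  shows "\<mu> b \<le> \<mu> a"
  using ba_measure_diff[OF assms] assms(1) by (simp add: ba_measure_def)

lemma le_diff_iff_disjoint: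
  fixes a b u :: "'a::boolean_algebra"
  shows "b \<le> u - a \<longleftrightarrow> b \<le> u \<and> inf a b = bot"
  by (auto simp: diff_eq inf_shunt[of b a] inf_commute[of a b])

text \<open>The bound is an arbitrary \<open>u\<close> so that the induction can shrink it: once
  \<open>p\<close> is split off, the other elements lie below \<open>u - p\<close>.\<close>

lemma sum_measure_disjoint_le:
  assumes "ba_measure \<mu>" and "finite S" and "pairwise_disjoint S" and "\<forall>p\<in>S. p \<le> u"
  shows "sum \<mu> S \<le> \<mu> u"
  using assms(2-4)
proof (induction S arbitrary: u)
  case empty
  then show ?case using assms(1) by (simp add: ba_measure_def)
next
  case (insert p S)
  have "\<forall>q\<in>S. q \<le> u - p"
    using insert.prems insert.hyps(2) by (auto simp: le_diff_iff_disjoint pairwise_insert)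
  then have "sum \<mu> S \<le> \<mu> (u - p)"
    using insert.IH insert.prems(1) by (auto simp: pairwise_insert)
  moreover have "\<mu> u = \<mu> p + \<mu> (u - p)"
    using ba_measure_diff[OF assms(1)] insert.prems(2) by blast
  ultimately show ?case using insert.hyps by simp
qed

text \<open>By strict positivity every member has measure above some 1/(n+1). For fixed n there are
  at most n such members, since n+1 disjoint ones would have total measure above 1. So
  \<open>P\<close> is a countable union of finite sets.\<close>

lemma countable_disjoint:
  fixes \<mu> :: "'a::boolean_algebra \<Rightarrow> real" and P :: "'a set"
  assumes "ba_measure \<mu>" and "strictly_positive \<mu>" and "bot \<notin> P" and "pairwise_disjoint P"
  shows "countable P"
proof -
  let ?L = "\<lambda>n::nat. {p\<in>P. inverse (real (Suc n)) < \<mu> p}"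
  have "finite (?L n)" for n
  proof (rule ccontr)
    assume "infinite (?L n)"
    then obtain S where S: "S \<subseteq> ?L n" "finite S" "card S = Suc n"
      using infinite_arbitrarily_large by blast
    have "1 = (\<Sum>p\<in>S. inverse (real (Suc n)))"
      using S(3) by simp
    also have "\<dots> < sum \<mu> S"
      using S by (intro sum_strict_mono) auto
    also have "\<dots> \<le> \<mu> top"
      using S(1) by (intro sum_measure_disjoint_le assms(1) S(2) pairwise_subset[OF assms(4)]) auto
    finally show False
      using assms(1) by (simp add: ba_measure_def)
  qed
  then have "countable (\<Union>n. ?L n)"
    by (simp add: countable_finite)
  moreover have "P \<subseteq> (\<Union>n. ?L n)"
  proof
    fix p assume "p \<in> P"
    then have "0 < \<mu> p"
      using assms(2,3) by (metis strictly_positive_def)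
    then show "p \<in> (\<Union>n. ?L n)"
      using reals_Archimedean \<open>p \<in> P\<close> by blast
  qed
  ultimately show ?thesis by (rule countable_subset[rotated])
qed

text \<open>An upper bound \<open>x\<close> of \<open>P\<close> corresponds to the element
  \<open>- x\<close> disjoint from all of \<open>P\<close>. This turns the supremum condition into
  maximality of an antichain, the form in which Zorn's lemma delivers it.\<close>

lemma isLub_UNIV_top_iff:
  fixes P :: "'a::boolean_algebra set"
  shows "isLub UNIV P top \<longleftrightarrow> (\<forall>b. (\<forall>p\<in>P. inf p b = bot) \<longrightarrow> b = bot)"
proof -
  have "isLub UNIV P top \<longleftrightarrow> (\<forall>x. (\<forall>p\<in>P. p \<le> x) \<longrightarrow> x = top)"
    by (auto simp: isLub_def leastP_def isUb_def setle_def setge_def top_le)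
  also have "\<dots> \<longleftrightarrow> (\<forall>b. (\<forall>p\<in>P. p \<le> - b) \<longrightarrow> - b = top)"
    by (metis double_compl)
  also have "\<dots> \<longleftrightarrow> (\<forall>b. (\<forall>p\<in>P. inf p b = bot) \<longrightarrow> b = bot)"
    by (simp add: inf_shunt compl_eq_compl_iff[of _ bot, simplified])
  finally show ?thesis .
qed

text \<open>In a partition into pieces of measure at most half of \<open>\<mu> b\<close>, some piece
  \<open>p\<close> meets \<open>b\<close>, and \<open>inf p b\<close> is too small to be all of
  \<open>b\<close>.\<close>

lemma non_atomic_split:
  fixes \<mu> :: "'a::boolean_algebra \<Rightarrow> real" and b :: 'a
  assumes "ba_measure \<mu>" and "non_atomic \<mu>" and "strictly_positive \<mu>" and "b \<noteq> bot"
  shows "\<exists>c. c \<noteq> bot \<and> c < b"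
proof -
  have pos: "0 < \<mu> b" using assms by (simp add: strictly_positive_def)
  then obtain P where P: "partition_of_unity P" "\<forall>a\<in>P. \<mu> a \<le> \<mu> b / 2"
    using assms(2) unfolding non_atomic_def by (meson half_gt_zero)
  then obtain p where p: "p \<in> P" "inf p b \<noteq> bot"
    using assms(4) by (auto simp: partition_of_unity_def isLub_UNIV_top_iff)
  have "\<mu> (inf p b) \<le> \<mu> p"
    by (intro ba_measure_mono assms(1)) simp
  then have "\<mu> (inf p b) < \<mu> b"
    using P(2) p(1) pos by force
  then have "inf p b < b" by (metis inf_le2 less_irrefl order_le_less)
  with p(2) show ?thesis by blast
qed

lemma Well_order_ur_below: "ba_measure \<mu> \<Longrightarrow> Well_order (ur_below \<mu> u)"
  using ur_below_least[of \<mu> u] by (metis card_of_Well_order)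

text \<open>A family dense below \<open>a\<close> stays dense below \<open>b\<close> when only its
  members below \<open>b\<close> are kept: whatever approximates \<open>c \<le> b\<close> from
  inside is itself below \<open>b\<close>.\<close>

lemma ur_below_mono:
  assumes "ba_measure \<mu>" and "b \<le> a"
  shows "ur_below \<mu> b \<le>o ur_below \<mu> a"
proof -
  obtain F where F: "uniformly_dense_below \<mu> a F" "ur_below \<mu> a = |F|"
    using ur_below_least[OF assms(1)] by blast
  have "uniformly_dense_below \<mu> b (F \<inter> {..b})"
    unfolding uniformly_dense_below_def
  proof (intro conjI ballI allI impI)
    fix c \<epsilon> assume c: "c \<in> {..b}" and "0 < (\<epsilon>::real)"
    moreover have "c \<in> {..a}" using c assms(2) by simp
    ultimately obtain f where "f \<in> F" "f \<le> c" "\<mu> (c - f) < \<epsilon>"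
      using F(1) unfolding uniformly_dense_below_def by blast
    then show "\<exists>f\<in>F \<inter> {..b}. f \<le> c \<and> \<mu> (c - f) < \<epsilon>"
      using c by (intro bexI[of _ f]) auto
  qed simp
  then have "ur_below \<mu> b \<le>o |F \<inter> {..b}|"
    using ur_below_least[OF assms(1)] by blast
  also have "|F \<inter> {..b}| \<le>o |F|"
    by (rule card_of_mono1) simp
  finally show ?thesis by (simp add: F(2))
qed

text \<open>Among the non-zero elements below \<open>b\<close>, one with least \<open>ur\<close> is
  homogeneous: for its non-zero parts, monotonicity gives one inequality and minimality the
  other.\<close>

lemma homogeneous_below:
  fixes \<mu> :: "'a::boolean_algebra \<Rightarrow> real"
  assumes "ba_measure \<mu>" and "b \<noteq> bot"
  obtains c where "homogeneous \<mu> c" and "c \<le> b"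
proof -
  let ?R = "{ur_below \<mu> c | c. c \<noteq> bot \<and> c \<le> b}"
  have "?R \<noteq> {}" using assms(2) by blast
  moreover have "\<forall>r\<in>?R. Well_order r"
    using Well_order_ur_below[OF assms(1)] by blast
  ultimately have "\<exists>\<kappa>\<in>?R. \<forall>r\<in>?R. \<kappa> \<le>o r"
    by (rule exists_minim_Well_order)
  then obtain c where c: "c \<noteq> bot" "c \<le> b"
    and min: "\<And>d. d \<noteq> bot \<Longrightarrow> d \<le> b \<Longrightarrow> ur_below \<mu> c \<le>o ur_below \<mu> d"
    by blast
  have "ur_below \<mu> d =o ur_below \<mu> c" if "d \<noteq> bot" "d \<le> c" for d
    using ur_below_mono[OF assms(1) that(2)] min[OF that(1) order_trans[OF that(2) c(2)]]
    by (simp add: ordIso_iff_ordLeq)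
  then have "homogeneous \<mu> c"
    using c(1) by (simp add: homogeneous_def)
  then show thesis using c(2) by (rule that)
qed

lemma homogeneous_antimono:
  assumes "homogeneous \<mu> a" and "b \<noteq> bot" and "b \<le> a"
  shows "homogeneous \<mu> b"
  using assms unfolding homogeneous_def
  by (meson order_trans ordIso_symmetric ordIso_transitive)

text \<open>Cutting a homogeneous \<open>h\<close> again and again gives a strictly decreasing
  sequence. Its successive differences are non-zero, disjoint and below \<open>h\<close>, hence
  homogeneous.\<close>

lemma infinite_disjoint_homogeneous:
  fixes \<mu> :: "'a::boolean_algebra \<Rightarrow> real"
  assumes "ba_measure \<mu>" and "non_atomic \<mu>" and "strictly_positive \<mu>"
  obtains D where "infinite D" and "pairwise_disjoint D" and "\<forall>d\<in>D. homogeneous \<mu> d"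
proof -
  \<comment> \<open>Splitting \<open>bot\<close> off itself gives \<open>\<mu> bot = 0\<close>,
    whereas \<open>\<mu> top = 1\<close>.\<close>
  have "(top :: 'a) \<noteq> bot"
    using ba_measure_diff[OF assms(1), of bot bot] assms(1) by (auto simp: ba_measure_def diff_eq)
  then obtain h where h: "homogeneous \<mu> h"
    using homogeneous_below[OF assms(1)] by blast
  obtain s :: "'a \<Rightarrow> 'a" where s: "\<And>b. b \<noteq> bot \<Longrightarrow> s b \<noteq> bot" "\<And>b. b \<noteq> bot \<Longrightarrow> s b < b"
    using non_atomic_split[OF assms] by metis
  define x where "x n = (s ^^ n) h" for n
  have x_nonzero: "x n \<noteq> bot" for n
    using h s(1) by (induction n) (auto simp: x_def homogeneous_def)
  have x_less: "x (Suc n) < x n" for n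
    using s(2)[OF x_nonzero] by (simp add: x_def)
  have x_anti: "x n \<le> x m" if "m \<le> n" for m n
    using lift_Suc_antimono_le[of x, OF less_imp_le[OF x_less] that] .
  define d where "d n = x n - x (Suc n)" for n
  have d_nonzero: "d n \<noteq> bot" for n
    using x_less[of n] by (simp add: d_def diff_eq inf_shunt leD)
  have d_disj: "inf (d m) (d n) = bot" if "m \<noteq> n" for m n
  proof -
    have *: "inf (d m) (d n) = bot" if "m < n" for m n
    proof -
      \<comment> \<open>For m < n, \<open>d n\<close> lies inside \<open>x (Suc m)\<close>, exactly
        what was removed from \<open>x m\<close> to form \<open>d m\<close>.\<close>
      have "d n \<le> x (Suc m)"
        using x_anti[of "Suc m" n] that by (auto simp: d_def diff_eq intro: le_infI1)
      moreover have "inf (d m) (x (Suc m)) = bot"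
        by (simp add: d_def diff_eq inf_assoc)
      ultimately show ?thesis by (metis bot.extremum_uniqueI inf_mono order_refl)
    qed
    show ?thesis using *[of m n] *[of n m] that by (metis inf_commute linorder_neqE_nat)
  qed
  \<comment> \<open>A value taken at two indices would be disjoint from itself, hence zero.\<close>
  have "inj d"
    by (rule injI) (metis d_disj d_nonzero inf_idem)
  have "d n \<le> h" for n
    using x_anti[of 0 n] by (auto simp: d_def diff_eq x_def intro: le_infI1)
  then have "\<forall>y\<in>range d. homogeneous \<mu> y"
    using homogeneous_antimono[OF h d_nonzero] by blast
  moreover have "pairwise_disjoint (range d)"
    by (rule pairwise_imageI) (rule d_disj)
  ultimately show thesis
    using that range_inj_infinite[OF \<open>inj d\<close>] by blast
qed

text \<open>Zorn's lemma gives a maximal disjoint family of homogeneous elements containing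
  \<open>D\<close>. A non-zero element disjoint from all its members would contain a homogeneous one
  that could still be added.\<close>

lemma homogeneous_partition_extends:
  fixes \<mu> :: "'a::boolean_algebra \<Rightarrow> real"
  assumes "ba_measure \<mu>" and "pairwise_disjoint D" and "\<forall>d\<in>D. homogeneous \<mu> d"
  obtains P where "D \<subseteq> P" and "partition_of_unity P" and "\<forall>p\<in>P. homogeneous \<mu> p"
proof -
  define A where "A = {P. D \<subseteq> P \<and> pairwise_disjoint P \<and> (\<forall>p\<in>P. homogeneous \<mu> p)}"
  have "\<exists>P\<in>A. \<forall>X\<in>A. P \<subseteq> X \<longrightarrow> X = P"
  proof (rule subset_Zorn_nonempty)
    show "A \<noteq> {}" using assms(2,3) by (auto simp: A_def)
    fix C assume C: "C \<noteq> {}" "subset.chain A C"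
    have "chain\<^sub>\<subseteq> C"
      using C(2) unfolding subset.chain_def chain_subset_def by blast
    then have "pairwise_disjoint (\<Union>C)"
      using C(2) by (intro pairwise_chain_Union) (auto simp: A_def subset.chain_def)
    moreover have "C \<subseteq> A"
      using C(2) by (simp add: subset.chain_def)
    \<comment> \<open>A chain with at least one member has \<open>D\<close> inside its
      union.\<close>
    ultimately show "\<Union>C \<in> A"
      using C(1) unfolding A_def by blast
  qed
  then obtain P where P: "P \<in> A" and max: "\<And>X. X \<in> A \<Longrightarrow> P \<subseteq> X \<Longrightarrow> X = P"
    by blast
  have "b = bot" if disj: "\<forall>p\<in>P. inf p b = bot" for b
  proof (rule ccontr)
    assume "b \<noteq> bot"
    then obtain c where c: "homogeneous \<mu> c" "c \<le> b"
      by (rule homogeneous_below[OF assms(1)])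
    have pc: "inf p c = bot" if "p \<in> P" for p
      using disj that c(2) by (metis bot.extremum_uniqueI inf_mono order_refl)
    then have "insert c P \<in> A"
      using P c(1) by (auto simp: A_def pairwise_insert inf_commute)
    \<comment> \<open>Maximality puts \<open>c\<close> into \<open>P\<close>, so \<open>c\<close> is
      disjoint from itself and thus zero, contrary to homogeneity.\<close>
    then have "c \<in> P" using max by blast
    then show False using pc[of c] c(1) by (simp add: homogeneous_def)
  qed
  then have "isLub UNIV P top"
    by (simp add: isLub_UNIV_top_iff)
  then show thesis
    using P by (intro that[of P]) (auto simp: A_def partition_of_unity_def homogeneous_def)
qed

theorem lemma5p1:
  fixes \<mu> :: "'a::boolean_algebra \<Rightarrow> real"
  assumes "ba_measure \<mu>" and "non_atomic \<mu>" and "strictly_positive \<mu>"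
  shows "\<exists>a :: nat \<Rightarrow> 'a. inj a \<and> partition_of_unity (range a) \<and>
    (\<forall>n b. b \<noteq> bot \<and> b \<le> a n \<longrightarrow> ur_below \<mu> b =o ur_below \<mu> (a n))"
proof -
  obtain D where D: "infinite D" "pairwise_disjoint D" "\<forall>d\<in>D. homogeneous \<mu> d"
    by (rule infinite_disjoint_homogeneous[OF assms])
  obtain P where P: "D \<subseteq> P" "partition_of_unity P" "\<forall>p\<in>P. homogeneous \<mu> p"
    by (rule homogeneous_partition_extends[OF assms(1) D(2,3)])
  have "infinite P" using D(1) P(1) infinite_super by blast
  moreover have "countable P"
    using countable_disjoint[OF assms(1,3)] P(2) by (simp add: partition_of_unity_def)
  \<comment> \<open>Infinity of \<open>P\<close> makes its enumeration free of repetitions, which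
    yields \<open>inj a\<close>.\<close>
  ultimately have bij: "bij_betw (from_nat_into P) UNIV P"
    by (intro bij_betw_from_nat_into)
  then have range: "range (from_nat_into P) = P"
    by (rule bij_betw_imp_surj_on)
  have "homogeneous \<mu> (from_nat_into P n)" for n
    using P(3) range by blast
  then show ?thesis
    using bij_betw_imp_inj_on[OF bij] P(2) range
    by (intro exI[of _ "from_nat_into P"]) (auto simp: homogeneous_def)
qed

end
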